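(* For all integers $n\geq 0$, $p_{\mathrm{ed}}^{\mathrm{od}}(n)\leq p^{\mathrm{ed}}_{\mathrm{od}}(n)$. Moreover, $p_{\mathrm{ed}}^{\mathrm{od}}(n)< p^{\mathrm{ed}}_{\mathrm{od}}(n)$ for all $n\geq 11$.
   Context: A partition of a non-negative integer $n$ is a non-increasing (finite, possibly empty) sequence of positive integers, called parts, summing to $n$. $p_{\mathrm{ed}}^{\mathrm{od}}(n)$ is the number of partitions of $n$ in which every odd part is larger than every even part, the odd parts are pairwise distinct, and the even parts are pairwise distinct. $p^{\mathrm{ed}}_{\mathrm{od}}(n)$ is the number of partitions of $n$ in which every even part is larger than every odd part, the even parts are pairwise distinct, and the odd parts are pairwise distinct. In both cases partitions with no even parts or with no odd parts are allowed. *)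

theory Defs
  imports Main
begin

definition is_partition :: "nat \<Rightarrow> nat list \<Rightarrow> bool" where
  "is_partition n xs \<longleftrightarrow>
     sorted_wrt (\<ge>) xs \<and> (\<forall>x\<in>set xs. x > 0) \<and> sum_list xs = n"

(* In the names below, the first component is the superscript (the parity of the larger parts)
   and the second one is the subscript (the parity of the smaller parts). *)

definition od_ed_partitions :: "nat \<Rightarrow> nat list set" where
  "od_ed_partitions n = {xs. is_partition n xs
     \<and> (\<forall>x\<in>set xs. \<forall>y\<in>set xs. odd x \<longrightarrow> even y \<longrightarrow> x > y)
     \<and> distinct (filter odd xs) \<and> distinct (filter even xs)}"

definition ed_od_partitions :: "nat \<Rightarrow> nat list set" where
  "ed_od_partitions n = {xs. is_partition n xs
     \<and> (\<forall>x\<in>set xs. \<forall>y\<in>set xs. even x \<longrightarrow> odd y \<longrightarrow> x > y)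
     \<and> distinct (filter even xs) \<and> distinct (filter odd xs)}"

definition p_od_ed :: "nat \<Rightarrow> nat" where
  "p_od_ed n = card (od_ed_partitions n)"

definition p_ed_od :: "nat \<Rightarrow> nat" where
  "p_ed_od n = card (ed_od_partitions n)"

(* Finiteness, so that card is the actual number of partitions. *)

lemma finite_partitions: "finite {xs. is_partition n xs}"
proof (rule finite_subset)
  have len: "length xs \<le> sum_list xs" if "\<forall>x\<in>set xs. x > 0" for xs :: "nat list"
    using that by (induction xs) auto
  show "{xs. is_partition n xs} \<subseteq> {xs. set xs \<subseteq> {..n} \<and> length xs \<le> n}"
    using len member_le_sum_list by (fastforce simp: is_partition_def)
  show "finite {xs. set xs \<subseteq> {..n} \<and> length xs \<le> n}"
    by (rule finite_lists_length_le) simp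
qed

lemma finite_od_ed_partitions: "finite (od_ed_partitions n)"
  by (rule finite_subset[OF _ finite_partitions]) (auto simp: od_ed_partitions_def)

lemma finite_ed_od_partitions: "finite (ed_od_partitions n)"
  by (rule finite_subset[OF _ finite_partitions]) (auto simp: ed_od_partitions_def)

end

theory Submission
  imports Defs
begin

text \<open>
  A partition counted on either side that has \<open>m\<close> parts, \<open>j\<close> of them even with \<open>0 < j < m\<close>,
  is encoded by \<open>j\<close> and a strictly decreasing list \<open>v\<close> of \<open>m\<close> naturals. If the odd parts come
  first, the parts are \<open>2 v\<^sub>i + 1\<close> (odd) and \<open>2 v\<^sub>i + 2\<close> (even), and they sum to
  \<open>2 (\<Sum> v) + m + j\<close>. If the even parts come first, the parts are \<open>2 v\<^sub>i\<close> (even) and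
  \<open>2 v\<^sub>i + 1\<close> (odd), and they sum to \<open>2 (\<Sum> v) + m - j\<close>. Adding \<open>j\<close> to the
  largest entry of \<open>v\<close> therefore turns partitions of the first kind injectively into partitions
  of the second kind of the same number. Partitions whose parts all have the same parity are of
  both kinds and are left unchanged. In the image the two largest entries of \<open>v\<close> differ by more
  than \<open>j\<close>, and for \<open>n \<ge> 11\<close> some partition into three parts violates this.
\<close>

definition num_even :: "nat list \<Rightarrow> nat" where
  "num_even xs = length (filter even xs)"

definition mixed :: "nat list \<Rightarrow> bool" where
  "mixed xs \<longleftrightarrow> 0 < num_even xs \<and> num_even xs < length xs"

definition odds_first :: "nat \<Rightarrow> nat list \<Rightarrow> nat list" where
  "odds_first j v = map (\<lambda>a. 2 * a + 1) (take (length v - j) v) @ map (\<lambda>a. 2 * a + 2) (drop (length v - j) v)"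

definition evens_first :: "nat \<Rightarrow> nat list \<Rightarrow> nat list" where
  "evens_first j v = map (\<lambda>a. 2 * a) (take j v) @ map (\<lambda>a. 2 * a + 1) (drop j v)"

fun raise_head :: "nat \<Rightarrow> nat list \<Rightarrow> nat list" where
  "raise_head j [] = []"
| "raise_head j (a # v) = (a + j) # v"

text \<open>Since \<open>2 * a + 1\<close> and \<open>2 * a + 2\<close> are both sent to
  \<open>a\<close>, no case distinction on parity is needed.\<close>

definition odds_first_code :: "nat list \<Rightarrow> nat list" where
  "odds_first_code xs = map (\<lambda>x. (x - 1) div 2) xs"

definition evens_up :: "nat list \<Rightarrow> nat list" where
  "evens_up xs = (if mixed xs
     then evens_first (num_even xs) (raise_head (num_even xs) (odds_first_code xs)) else xs)"

section \<open>Strictly decreasing lists and their parity blocks\<close>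

lemma sorted_wrt_greater_iff_distinct:
  fixes xs :: "'a::linorder list"
  shows "sorted_wrt (>) xs \<longleftrightarrow> sorted_wrt (\<ge>) xs \<and> distinct xs"
  by (induction xs) (auto simp: order.order_iff_strict)

lemma distinct_filter_not_iff:
  "distinct (filter P xs) \<and> distinct (filter (\<lambda>x. \<not> P x) xs) \<longleftrightarrow> distinct xs"
  by (induction xs) auto

lemma sorted_wrt_separated_eq_append:
  fixes xs :: "'a::linorder list"
  assumes "sorted_wrt (>) xs" "\<forall>x\<in>set xs. \<forall>y\<in>set xs. P x \<longrightarrow> \<not> P y \<longrightarrow> x > y"
  shows "xs = filter P xs @ filter (\<lambda>x. \<not> P x) xs"
  using assms
proof (induction xs)
  case (Cons a xs)
  show ?case
  proof (cases "P a")
    case False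
    \<comment> \<open>A later entry satisfying \<open>P\<close> would have to exceed
      \<open>a\<close>, against the decreasing order.\<close>
    then have "filter P xs = []"
      using Cons.prems by (fastforce simp: filter_empty_conv)
    with False Cons show ?thesis by auto
  qed (use Cons in auto)
qed simp

lemma od_ed_partitions_iff:
  "xs \<in> od_ed_partitions n \<longleftrightarrow> sorted_wrt (>) xs \<and> (\<forall>x\<in>set xs. x > 0) \<and> sum_list xs = n
     \<and> (\<forall>x\<in>set xs. \<forall>y\<in>set xs. odd x \<longrightarrow> even y \<longrightarrow> x > y)"
  using distinct_filter_not_iff[of even xs]
  by (auto simp: od_ed_partitions_def is_partition_def sorted_wrt_greater_iff_distinct)

lemma ed_od_partitions_iff:
  "xs \<in> ed_od_partitions n \<longleftrightarrow> sorted_wrt (>) xs \<and> (\<forall>x\<in>set xs. x > 0) \<and> sum_list xs = n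
     \<and> (\<forall>x\<in>set xs. \<forall>y\<in>set xs. even x \<longrightarrow> odd y \<longrightarrow> x > y)"
  using distinct_filter_not_iff[of even xs]
  by (auto simp: ed_od_partitions_def is_partition_def sorted_wrt_greater_iff_distinct)

lemma not_mixed_same_parity:
  assumes "\<not> mixed xs" "x \<in> set xs" "y \<in> set xs"
  shows "even x \<longleftrightarrow> even y"
proof -
  have "filter even xs = [] \<or> length (filter even xs) = length xs"
    using assms(1) length_filter_le[of even xs] unfolding mixed_def num_even_def length_greater_0_conv
    by linarith
  then show ?thesis
    using assms(2,3) by (auto simp: filter_empty_conv dest: length_filter_less[of _ xs even])
qed

lemma odds_first_odds_first_code:
  assumes "xs \<in> od_ed_partitions n"
  shows "odds_first (num_even xs) (odds_first_code xs) = xs"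
proof -
  let ?os = "filter odd xs" and ?es = "filter even xs"
  have split: "xs = ?os @ ?es"
    using sorted_wrt_separated_eq_append[of xs odd] assms by (simp add: od_ed_partitions_iff)
  have code: "odds_first_code xs = odds_first_code ?os @ odds_first_code ?es"
    unfolding odds_first_code_def map_append[symmetric] split[symmetric] ..
  have "map (\<lambda>a. 2 * a + 1) (odds_first_code ?os) = ?os"
    by (auto simp: odds_first_code_def intro!: map_idI elim!: oddE)
  moreover have "map (\<lambda>a. 2 * a + 2) (odds_first_code ?es) = ?es"
    using assms by (auto simp: odds_first_code_def od_ed_partitions_iff intro!: map_idI)
      (auto elim!: evenE)
  ultimately have "odds_first (num_even xs) (odds_first_code xs) = ?os @ ?es"
    unfolding odds_first_def code by (simp add: num_even_def odds_first_code_def)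
  then show ?thesis by (simp only: split[symmetric])
qed

text \<open>Positive \<open>x > y\<close> have equal codes only if \<open>x = 2 * a + 2\<close> and
  \<open>y = 2 * a + 1\<close>, an even part above an odd one, which is excluded here.\<close>

lemma sorted_wrt_odds_first_code:
  assumes "xs \<in> od_ed_partitions n"
  shows "sorted_wrt (>) (odds_first_code xs)"
  unfolding odds_first_code_def sorted_wrt_map
proof (rule sorted_wrt_mono_rel)
  show "sorted_wrt (>) xs"
    using assms by (simp add: od_ed_partitions_iff)
next
  fix x y assume xy: "x \<in> set xs" "y \<in> set xs" "x > y"
  then have "y > 0" "odd y \<longrightarrow> even x \<longrightarrow> y > x"
    using assms by (auto simp: od_ed_partitions_iff)
  with xy(3) show "(x - 1) div 2 > (y - 1) div 2"
    by presburger
qed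

section \<open>Sums and decoding of the two encodings\<close>

lemma sum_list_double_add:
  "sum_list (map (\<lambda>a. 2 * a + c) v) = 2 * sum_list v + c * length (v :: nat list)"
  by (induction v) auto

lemma sum_list_take_drop: "sum_list (take k v) + sum_list (drop k v) = sum_list (v :: nat list)"
  by (metis append_take_drop_id sum_list_append)

lemma sum_list_odds_first:
  assumes "j \<le> length v"
  shows "sum_list (odds_first j v) = 2 * sum_list v + length v + j"
  using assms sum_list_take_drop[of "length v - j" v]
  by (simp add: odds_first_def sum_list_double_add[of 1, simplified] sum_list_double_add[of 2, simplified])

lemma sum_list_evens_first:
  assumes "j \<le> length v"
  shows "sum_list (evens_first j v) + j = 2 * sum_list v + length v"
  using assms sum_list_take_drop[of j v]
  by (simp add: evens_first_def sum_list_double_add[of 1, simplified] sum_list_double_add[of 0, simplified])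

lemma evens_first_code: "map (\<lambda>x. x div 2) (evens_first j v) = v"
  by (simp add: evens_first_def o_def)

lemma length_evens_first [simp]: "length (evens_first j v) = length v"
  by (simp add: evens_first_def)

lemma num_even_evens_first: "j \<le> length v \<Longrightarrow> num_even (evens_first j v) = j"
  by (simp add: num_even_def evens_first_def filter_map o_def)

lemma evens_first_in_ed_od_partitions:
  assumes "sorted_wrt (>) v" "j < length v" "2 * sum_list v + length v = n + j"
  shows "evens_first j v \<in> ed_od_partitions n"
proof -
  have gt: "a > b" if "a \<in> set (take j v)" "b \<in> set (drop j v)" for a b
    using assms(1) that sorted_wrt_append[of "(>)" "take j v" "drop j v"] by auto
  \<comment> \<open>An even part \<open>2 * a\<close> might be 0. As some odd part exists,
    \<open>a\<close> exceeds an entry of \<open>drop j v\<close> and is positive.\<close>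
  have "drop j v \<noteq> []" using assms(2) by simp
  then have pos: "a > 0" if "a \<in> set (take j v)" for a
    using gt[OF that] by (metis gr_zeroI last_in_set not_less_zero)
  have "sorted_wrt (>) (take j v)" "sorted_wrt (>) (drop j v)"
    using assms(1) by (simp_all add: sorted_wrt_take sorted_wrt_drop)
  then have "sorted_wrt (>) (evens_first j v)"
    using gt by (fastforce simp: evens_first_def sorted_wrt_append sorted_wrt_map)
  moreover have "sum_list (evens_first j v) = n"
    using sum_list_evens_first[of j v] assms by simp
  ultimately show ?thesis
    unfolding ed_od_partitions_iff using gt pos by (fastforce simp: evens_first_def)
qed

section \<open>The injection\<close>

lemma length_raise_head [simp]: "length (raise_head j v) = length v"
  by (cases v) auto

lemma sum_list_raise_head: "v \<noteq> [] \<Longrightarrow> sum_list (raise_head j v) = sum_list v + j"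
  by (cases v) auto

lemma sorted_wrt_raise_head: "sorted_wrt (>) v \<Longrightarrow> sorted_wrt (>) (raise_head j v)"
  by (cases v) auto

lemma inj_raise_head: "inj (raise_head j)"
proof (rule injI)
  show "v = w" if "raise_head j v = raise_head j w" for v w
    using that by (cases v; cases w) auto
qed

text \<open>Length and number of even parts survive, so a changed list and an unchanged one never
  have the same image.\<close>

lemma mixed_evens_up [simp]: "mixed (evens_up xs) \<longleftrightarrow> mixed xs"
  by (auto simp: evens_up_def mixed_def odds_first_code_def num_even_evens_first)

lemma evens_up_decode:
  assumes "mixed xs"
  shows "num_even (evens_up xs) = num_even xs"
    and "map (\<lambda>x. x div 2) (evens_up xs) = raise_head (num_even xs) (odds_first_code xs)"
  using assms
  by (simp_all add: evens_up_def mixed_def odds_first_code_def num_even_evens_first evens_first_code)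

lemma evens_up_in_ed_od_partitions:
  assumes "xs \<in> od_ed_partitions n"
  shows "evens_up xs \<in> ed_od_partitions n"
proof (cases "mixed xs")
  case True
  let ?j = "num_even xs" and ?v = "odds_first_code xs"
  have j: "?j < length ?v" "?v \<noteq> []"
    using True by (auto simp: mixed_def odds_first_code_def)
  \<comment> \<open>Raising the head adds \<open>2 * ?j\<close> to twice the sum, which turns this
    into the equation with right-hand side \<open>n + ?j\<close> required for
    \<open>evens_first\<close>.\<close>
  have "2 * sum_list ?v + length ?v + ?j = n"
    using sum_list_odds_first[of ?j ?v] odds_first_odds_first_code[OF assms] j assms
    by (simp add: od_ed_partitions_iff)
  then have "evens_first ?j (raise_head ?j ?v) \<in> ed_od_partitions n"
    using j sorted_wrt_odds_first_code[OF assms]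
    by (intro evens_first_in_ed_od_partitions) (simp_all add: sorted_wrt_raise_head sum_list_raise_head)
  with True show ?thesis by (simp add: evens_up_def)
next
  case False
  then have "evens_up xs = xs" by (simp add: evens_up_def)
  moreover have "\<forall>x\<in>set xs. \<forall>y\<in>set xs. even x \<longrightarrow> odd y \<longrightarrow> x > y"
    using not_mixed_same_parity[OF False] by blast
  ultimately show ?thesis
    using assms by (simp add: od_ed_partitions_iff ed_od_partitions_iff)
qed

lemma inj_on_evens_up: "inj_on evens_up (od_ed_partitions n)"
proof (rule inj_onI)
  fix xs ys
  assume xs: "xs \<in> od_ed_partitions n" and ys: "ys \<in> od_ed_partitions n"
    and eq: "evens_up xs = evens_up ys"
  have same: "mixed xs \<longleftrightarrow> mixed ys"
    using eq by (metis mixed_evens_up)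
  show "xs = ys"
  proof (cases "mixed xs")
    case True
    then have "num_even xs = num_even ys" "odds_first_code xs = odds_first_code ys"
      using evens_up_decode[of xs] evens_up_decode[of ys] same eq by (auto dest: injD[OF inj_raise_head])
    then show ?thesis
      by (metis odds_first_odds_first_code xs ys)
  qed (use same eq in \<open>simp add: evens_up_def\<close>)
qed

section \<open>Partitions outside the image\<close>

lemma evens_up_head_gap:
  assumes "xs \<in> od_ed_partitions n" "mixed xs" "map (\<lambda>x. x div 2) (evens_up xs) = a # b # w"
  shows "a > b + num_even (evens_up xs)"
proof -
  obtain a' where "odds_first_code xs = a' # b # w" "a = a' + num_even xs"
    using evens_up_decode(2)[OF assms(2)] assms(3)
    by (cases "odds_first_code xs") auto
  then show ?thesis
    using sorted_wrt_odds_first_code[OF assms(1)] evens_up_decode(1)[OF assms(2)] by simp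
qed

text \<open>The parity of \<open>n\<close> forces \<open>j\<close>: 2 for odd \<open>n\<close>, 1
  for even \<open>n\<close>. Then \<open>a\<close> and \<open>b\<close> are taken nearly equal, and
  \<open>c\<close> corrects the parity of the sum. For \<open>n = 10\<close> no such triple exists:
  \<open>j = 1\<close> gives \<open>a = b + 1\<close> and \<open>2 * b + c = 3\<close>, against
  \<open>b > c\<close>.\<close>

lemma ex_ed_od_partition_small_gap:
  fixes n :: nat
  assumes "n \<ge> 11"
  obtains j a b c where "0 < j" "j < 3" "a > b" "b > c" "a \<le> b + j" "2 * (a + b + c) + 3 = n + j"
proof -
  consider t where "n = 4 * t + 1" | t where "n = 4 * t + 2" | t where "n = 4 * t + 3" | t where "n = 4 * t"
    by atomize_elim presburger
  then show ?thesis
  proof cases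
    case (1 t)
    then show ?thesis using assms by (intro that[where j = 2 and a = "t + 1" and b = "t - 1" and c = 0]) auto
  next
    case (2 t)
    then show ?thesis using assms by (intro that[where j = 1 and a = t and b = "t - 1" and c = 1]) auto
  next
    case (3 t)
    then show ?thesis using assms by (intro that[where j = 2 and a = "t + 1" and b = t and c = 0]) auto
  next
    case (4 t)
    then show ?thesis using assms by (intro that[where j = 1 and a = t and b = "t - 1" and c = 0]) auto
  qed
qed

lemma evens_up_not_surj:
  assumes "n \<ge> 11"
  shows "evens_up ` od_ed_partitions n \<subset> ed_od_partitions n"
proof -
  obtain j a b c where jabc: "0 < j" "j < 3" "a > b" "b > c" "a \<le> b + j"
    "2 * (a + b + c) + 3 = n + j"
    using assms by (rule ex_ed_od_partition_small_gap)
  let ?ys = "evens_first j [a, b, c]"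
  have even_ys: "num_even ?ys = j"
    using jabc by (simp add: num_even_evens_first)
  have "?ys \<in> ed_od_partitions n"
    using jabc by (intro evens_first_in_ed_od_partitions) auto
  moreover have "?ys \<notin> evens_up ` od_ed_partitions n"
  proof
    assume "?ys \<in> evens_up ` od_ed_partitions n"
    then obtain xs where xs: "xs \<in> od_ed_partitions n" "evens_up xs = ?ys"
      by auto
    \<comment> \<open>Three parts with \<open>0 < j < 3\<close> include both parities, so a preimage
      cannot come from the unchanged case and the gap bound applies.\<close>
    have "mixed ?ys"
      using jabc by (simp add: mixed_def even_ys)
    then have "mixed xs"
      using xs(2) by (metis mixed_evens_up)
    then have "a > b + j"
      using evens_up_head_gap[OF xs(1)] xs(2) evens_first_code even_ys by metis
    with jabc show False by simp
  qed
  ultimately show ?thesis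
    using evens_up_in_ed_od_partitions by blast
qed

theorem theorem3p1:
  shows "(\<forall>n::nat. p_od_ed n \<le> p_ed_od n) \<and> (\<forall>n::nat. n \<ge> 11 \<longrightarrow> p_od_ed n < p_ed_od n)"
proof (intro conjI allI impI)
  show "p_od_ed n \<le> p_ed_od n" for n
    unfolding p_od_ed_def p_ed_od_def
    by (rule card_inj_on_le[OF inj_on_evens_up _ finite_ed_od_partitions])
      (auto intro: evens_up_in_ed_od_partitions)
  show "p_od_ed n < p_ed_od n" if "n \<ge> 11" for n
    using psubset_card_mono[OF finite_ed_od_partitions evens_up_not_surj[OF that]]
    by (simp add: p_od_ed_def p_ed_od_def card_image inj_on_evens_up)
qed

end
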